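(* Let $\mathbb{K}$ be a field of characteristic not $2$, let $\mathfrak{a}$ be a Lie affgebra over $\mathbb{K}$ with affine Lie bracket $\{-,-\}$, and let $\mathfrak{b}$ be an ideaf of $\mathfrak{a}$. Then the set $\mathfrak{a}/\mathfrak{b}$ of equivalence classes of the relation $\sim_{\mathfrak{b}}$ is a Lie affgebra with the (well-defined) operations $$\langle\overline{a_1},\overline{a_2},\overline{a_3}\rangle:=\overline{\langle a_1,a_2,a_3\rangle},\qquad \alpha\triangleright_{\overline{a_1}}\overline{a_2}:=\overline{\alpha\triangleright_{a_1}a_2},\qquad \{\overline{a_1},\overline{a_2}\}:=\overline{\{a_1,a_2\}}.$$
   Context: A heap is a set $H$ with a ternary operation $\langle-,-,-\rangle$ satisfying $\langle v,w,\langle x,y,z\rangle\rangle=\langle\langle v,w,x\rangle,y,z\rangle$ and $\langle x,x,y\rangle=y=\langle y,x,x\rangle$; it is abelian if $\langle x,y,z\rangle=\langle z,y,x\rangle$. An affine space over $\mathbb{K}$ is a non-empty abelian heap $H$ with a map $\mathbb{K}\times H\times H\to H$, $(\alpha,x,y)\mapsto\alpha\triangleright_x y$, such that $\alpha\triangleright_x-$ and $-\triangleright_x y$ are heap morphisms ($\mathbb{K}$ being a heap by $\alpha-\beta+\gamma$), $(\alpha\beta)\triangleright_x y=\alpha\triangleright_x(\beta\triangleright_x y)$, $\alpha\triangleright_x y=\langle\alpha\triangleright_z y,\alpha\triangleright_z x,x\rangle$, $0\triangleright_x y=x$, $1\triangleright_x y=y$. Affine maps are heap morphisms $f$ with $f(\alpha\triangleright_x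 y)=\alpha\triangleright_{f(x)}f(y)$; an affine subspace is a non-empty subset closed under both operations. A Lie affgebra is an affine space $\mathfrak{a}$ with a binary operation $\{-,-\}$, affine in each argument, such that $\langle\{a,b\},\{a,a\},\{b,a\}\rangle=\{b,b\}$ and $\langle\{a,\{b,c\}\},\{a,\{a,a\}\},\{b,\{c,a\}\},\{b,\{b,b\}\},\{c,\{a,b\}\}\rangle=\{c,\{c,c\}\}$ for all $a,b,c$, where $\langle x_1,\dots,x_5\rangle=\langle\langle x_1,x_2,x_3\rangle,x_4,x_5\rangle$. An ideaf of $\mathfrak{a}$ is an affine subspace $\mathfrak{b}$ such that $\{a,b\}\in\mathfrak{b}$ and $\{b,a\}\in\mathfrak{b}$ for all $a\in\mathfrak{a}$, $b\in\mathfrak{b}$. The relation $\sim_{\mathfrak{b}}$ on $\mathfrak{a}$ is the equivalence relation: $a_1\sim_{\mathfrak{b}}a_2$ iff there exists $b\in\mathfrak{b}$ with $\langle a_1,a_2,b\rangle\in\mathfrak{b}$ (equivalently, $\langle a_1,a_2,b\rangle\in\mathfrak{b}$ for all $b\in\mathfrak{b}$); $\overline{a}$ denotes the class of $a$. *)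

theory Defs
  imports Main
begin

(* Structures live on a carrier set A; every operation is constrained only on A and is
   unspecified elsewhere. *)

locale heap =
  fixes A :: "'a set" and tern :: "'a \<Rightarrow> 'a \<Rightarrow> 'a \<Rightarrow> 'a"
  assumes tern_closed: "\<lbrakk>x \<in> A; y \<in> A; z \<in> A\<rbrakk> \<Longrightarrow> tern x y z \<in> A"
    and tern_assoc: "\<lbrakk>v \<in> A; w \<in> A; x \<in> A; y \<in> A; z \<in> A\<rbrakk>
      \<Longrightarrow> tern v w (tern x y z) = tern (tern v w x) y z"
    and tern_left: "\<lbrakk>x \<in> A; y \<in> A\<rbrakk> \<Longrightarrow> tern x x y = y"
    and tern_right: "\<lbrakk>x \<in> A; y \<in> A\<rbrakk> \<Longrightarrow> tern y x x = y"

locale abelian_heap = heap +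
  assumes tern_commute: "\<lbrakk>x \<in> A; y \<in> A; z \<in> A\<rbrakk> \<Longrightarrow> tern x y z = tern z y x"

definition heap_morphism ::
  "'a set \<Rightarrow> ('a \<Rightarrow> 'a \<Rightarrow> 'a \<Rightarrow> 'a) \<Rightarrow> 'b set \<Rightarrow> ('b \<Rightarrow> 'b \<Rightarrow> 'b \<Rightarrow> 'b) \<Rightarrow> ('a \<Rightarrow> 'b) \<Rightarrow> bool"
  where "heap_morphism A tern A' tern' f \<longleftrightarrow>
    (\<forall>x\<in>A. f x \<in> A') \<and>
    (\<forall>x\<in>A. \<forall>y\<in>A. \<forall>z\<in>A. f (tern x y z) = tern' (f x) (f y) (f z))"

definition field_tern :: "'k::field \<Rightarrow> 'k \<Rightarrow> 'k \<Rightarrow> 'k"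
  where "field_tern \<alpha> \<beta> \<gamma> = \<alpha> - \<beta> + \<gamma>"

(* act \<alpha> x y is the action \<alpha> \<triangleright>\<^sub>x y, with base point x. *)
locale affine_space = abelian_heap A tern
  for A :: "'a set" and tern :: "'a \<Rightarrow> 'a \<Rightarrow> 'a \<Rightarrow> 'a" +
  fixes act :: "'k::field \<Rightarrow> 'a \<Rightarrow> 'a \<Rightarrow> 'a"
  assumes nonempty: "A \<noteq> {}"
    and act_morphism_point: "x \<in> A \<Longrightarrow> heap_morphism A tern A tern (\<lambda>y. act \<alpha> x y)"
    and act_morphism_scalar:
      "\<lbrakk>x \<in> A; y \<in> A\<rbrakk> \<Longrightarrow> heap_morphism UNIV field_tern A tern (\<lambda>\<alpha>. act \<alpha> x y)"
    and act_mult: "\<lbrakk>x \<in> A; y \<in> A\<rbrakk> \<Longrightarrow> act (\<alpha> * \<beta>) x y = act \<alpha> x (act \<beta> x y)"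
    and act_base_change: "\<lbrakk>x \<in> A; y \<in> A; z \<in> A\<rbrakk>
      \<Longrightarrow> act \<alpha> x y = tern (act \<alpha> z y) (act \<alpha> z x) x"
    and act_zero: "\<lbrakk>x \<in> A; y \<in> A\<rbrakk> \<Longrightarrow> act 0 x y = x"
    and act_one: "\<lbrakk>x \<in> A; y \<in> A\<rbrakk> \<Longrightarrow> act 1 x y = y"

definition affine_map ::
  "'a set \<Rightarrow> ('a \<Rightarrow> 'a \<Rightarrow> 'a \<Rightarrow> 'a) \<Rightarrow> ('k::field \<Rightarrow> 'a \<Rightarrow> 'a \<Rightarrow> 'a)
    \<Rightarrow> 'b set \<Rightarrow> ('b \<Rightarrow> 'b \<Rightarrow> 'b \<Rightarrow> 'b) \<Rightarrow> ('k \<Rightarrow> 'b \<Rightarrow> 'b \<Rightarrow> 'b) \<Rightarrow> ('a \<Rightarrow> 'b) \<Rightarrow> bool"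
  where "affine_map A tern act A' tern' act' f \<longleftrightarrow>
    heap_morphism A tern A' tern' f \<and>
    (\<forall>\<alpha>. \<forall>x\<in>A. \<forall>y\<in>A. f (act \<alpha> x y) = act' \<alpha> (f x) (f y))"

definition affine_subspace ::
  "'a set \<Rightarrow> ('a \<Rightarrow> 'a \<Rightarrow> 'a \<Rightarrow> 'a) \<Rightarrow> ('k::field \<Rightarrow> 'a \<Rightarrow> 'a \<Rightarrow> 'a) \<Rightarrow> 'a set \<Rightarrow> bool"
  where "affine_subspace A tern act B \<longleftrightarrow>
    B \<noteq> {} \<and> B \<subseteq> A \<and>
    (\<forall>x\<in>B. \<forall>y\<in>B. \<forall>z\<in>B. tern x y z \<in> B) \<and>
    (\<forall>\<alpha>. \<forall>x\<in>B. \<forall>y\<in>B. act \<alpha> x y \<in> B)"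

definition tern5 :: "('a \<Rightarrow> 'a \<Rightarrow> 'a \<Rightarrow> 'a) \<Rightarrow> 'a \<Rightarrow> 'a \<Rightarrow> 'a \<Rightarrow> 'a \<Rightarrow> 'a \<Rightarrow> 'a"
  where "tern5 tern x1 x2 x3 x4 x5 = tern (tern x1 x2 x3) x4 x5"

locale lie_affgebra = affine_space A tern act
  for A :: "'a set" and tern :: "'a \<Rightarrow> 'a \<Rightarrow> 'a \<Rightarrow> 'a"
    and act :: "'k::field \<Rightarrow> 'a \<Rightarrow> 'a \<Rightarrow> 'a" +
  fixes br :: "'a \<Rightarrow> 'a \<Rightarrow> 'a"
  assumes br_affine_right: "a \<in> A \<Longrightarrow> affine_map A tern act A tern act (\<lambda>b. br a b)"
    and br_affine_left: "b \<in> A \<Longrightarrow> affine_map A tern act A tern act (\<lambda>a. br a b)"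
    and br_antisym: "\<lbrakk>a \<in> A; b \<in> A\<rbrakk> \<Longrightarrow> tern (br a b) (br a a) (br b a) = br b b"
    and br_jacobi: "\<lbrakk>a \<in> A; b \<in> A; c \<in> A\<rbrakk> \<Longrightarrow>
      tern5 tern (br a (br b c)) (br a (br a a)) (br b (br c a)) (br b (br b b)) (br c (br a b))
        = br c (br c c)"

definition ideaf ::
  "'a set \<Rightarrow> ('a \<Rightarrow> 'a \<Rightarrow> 'a \<Rightarrow> 'a) \<Rightarrow> ('k::field \<Rightarrow> 'a \<Rightarrow> 'a \<Rightarrow> 'a) \<Rightarrow> ('a \<Rightarrow> 'a \<Rightarrow> 'a)
    \<Rightarrow> 'a set \<Rightarrow> bool"
  where "ideaf A tern act br B \<longleftrightarrow>
    affine_subspace A tern act B \<and> (\<forall>a\<in>A. \<forall>b\<in>B. br a b \<in> B \<and> br b a \<in> B)"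

definition sub_rel :: "'a set \<Rightarrow> ('a \<Rightarrow> 'a \<Rightarrow> 'a \<Rightarrow> 'a) \<Rightarrow> 'a set \<Rightarrow> ('a \<times> 'a) set"
  where "sub_rel A tern B = {(a1, a2). a1 \<in> A \<and> a2 \<in> A \<and> (\<exists>b\<in>B. tern a1 a2 b \<in> B)}"

(* Operations induced on classes of r: the union, over all representatives, of the class of
   the result (cf. UN_equiv_class). It is a single class exactly when the operation respects r. *)

definition quot_tern ::
  "('a \<times> 'a) set \<Rightarrow> ('a \<Rightarrow> 'a \<Rightarrow> 'a \<Rightarrow> 'a) \<Rightarrow> 'a set \<Rightarrow> 'a set \<Rightarrow> 'a set \<Rightarrow> 'a set"
  where "quot_tern r tern X Y Z = (\<Union>x\<in>X. \<Union>y\<in>Y. \<Union>z\<in>Z. r `` {tern x y z})"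

definition quot_act ::
  "('a \<times> 'a) set \<Rightarrow> ('k \<Rightarrow> 'a \<Rightarrow> 'a \<Rightarrow> 'a) \<Rightarrow> 'k \<Rightarrow> 'a set \<Rightarrow> 'a set \<Rightarrow> 'a set"
  where "quot_act r act \<alpha> X Y = (\<Union>x\<in>X. \<Union>y\<in>Y. r `` {act \<alpha> x y})"

definition quot_br ::
  "('a \<times> 'a) set \<Rightarrow> ('a \<Rightarrow> 'a \<Rightarrow> 'a) \<Rightarrow> 'a set \<Rightarrow> 'a set \<Rightarrow> 'a set"
  where "quot_br r br X Y = (\<Union>x\<in>X. \<Union>y\<in>Y. r `` {br x y})"

end

(* A heap morphism that sends any two elements of B to equivalent elements preserves the
   equivalence. This applies to the bracket in each argument and to the action with base point in
   B; base change then reduces the action with an arbitrary base point to the heap operation. Hence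
   the operations descend to classes, and with them the axioms, which are universally quantified
   equations. *)

theory Submission
  imports Defs
begin

section \<open>Rearranging nested brackets in a heap\<close>

context heap
begin

text \<open>With \<open>tern x y z\<close> read as x y^-1 z in a group, the inverse of the middle
  bracket reverses its order. The heap axioms give this without a group:
  \<open>tern (tern v y x) w ?p\<close> collapses to \<open>v\<close>, and substituting this for
  \<open>v\<close> makes the two copies of \<open>?p\<close> cancel.\<close>

lemma tern_assoc_mid:
  assumes "v \<in> A" "w \<in> A" "x \<in> A" "y \<in> A" "z \<in> A"
  shows "tern v (tern w x y) z = tern (tern v y x) w z"
proof -
  let ?p = "tern w x y"
  have p: "?p \<in> A" using assms by (simp add: tern_closed)
  have "tern (tern v y x) w ?p = tern (tern (tern v y x) w w) x y"
    using assms by (intro tern_assoc) (simp_all add: tern_closed)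
  also have "\<dots> = tern v y (tern x x y)"
    using assms by (simp add: tern_right tern_closed tern_assoc[of v y x x y])
  also have "\<dots> = v" using assms by (simp add: tern_left tern_right)
  finally have "tern (tern v y x) w ?p = v" .
  then have "tern v ?p z = tern (tern (tern v y x) w ?p) ?p z" by simp
  also have "\<dots> = tern (tern v y x) w z"
    using assms p by (simp add: tern_left tern_closed flip: tern_assoc)
  finally show ?thesis .
qed

end

section \<open>The quotient of an abelian heap by a sub-heap\<close>

locale heap_quotient = abelian_heap A tern
  for A :: "'a set" and tern :: "'a \<Rightarrow> 'a \<Rightarrow> 'a \<Rightarrow> 'a" +
  fixes B :: "'a set"
  assumes B_nonempty: "B \<noteq> {}"
    and B_subset: "B \<subseteq> A"
    and B_tern: "\<lbrakk>x \<in> B; y \<in> B; z \<in> B\<rbrakk> \<Longrightarrow> tern x y z \<in> B"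
begin

abbreviation rel :: "('a \<times> 'a) set" where "rel \<equiv> sub_rel A tern B"
abbreviation cls :: "'a \<Rightarrow> 'a set" where "cls a \<equiv> rel `` {a}"

lemma B_in: "b \<in> B \<Longrightarrow> b \<in> A"
  using B_subset by blast

lemma relI: "\<lbrakk>x \<in> A; y \<in> A; b \<in> B; tern x y b \<in> B\<rbrakk> \<Longrightarrow> (x, y) \<in> rel"
  by (auto simp: sub_rel_def)

lemma rel_carrier: "(x, y) \<in> rel \<Longrightarrow> x \<in> A \<and> y \<in> A"
  by (auto simp: sub_rel_def)

text \<open>Passes from the one witness \<open>c\<close> in \<open>sub_rel\<close> to every
  \<open>b\<close> in \<open>B\<close>: writing \<open>b\<close> as \<open>tern c c b\<close> and
  reassociating leaves a bracket of three elements of \<open>B\<close>.\<close>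

lemma rel_tern_mem:
  assumes "(x, y) \<in> rel" "b \<in> B"
  shows "tern x y b \<in> B"
proof -
  obtain c where c: "x \<in> A" "y \<in> A" "c \<in> B" "tern x y c \<in> B"
    using assms by (auto simp: sub_rel_def)
  have "tern x y b = tern x y (tern c c b)"
    using c assms by (simp add: tern_left B_in)
  also have "\<dots> = tern (tern x y c) c b"
    using c assms by (simp add: tern_assoc B_in)
  finally show ?thesis using c assms by (simp add: B_tern)
qed

lemma equiv_rel: "equiv A rel"
proof (rule equivI)
  obtain b where b: "b \<in> B" using B_nonempty by blast
  show "rel \<subseteq> A \<times> A" by (auto dest: rel_carrier)
  show "refl_on A rel"
    using b by (auto simp: refl_on_def tern_left B_in dest: rel_carrier intro: relI[of _ _ b])
  show "sym rel"
  proof (rule symI)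
    fix x y assume xy: "(x, y) \<in> rel"
    \<comment> \<open>The bracket with \<open>y\<close> and \<open>x\<close> undoes the one with
      \<open>x\<close> and \<open>y\<close>, so \<open>tern x y b\<close> witnesses the reversed
      pair.\<close>
    let ?c = "tern x y b"
    have A: "x \<in> A" "y \<in> A" "?c \<in> B" using xy b by (auto dest: rel_carrier rel_tern_mem)
    have "tern y x ?c = b"
      using A b by (simp add: tern_assoc tern_left tern_right B_in)
    with A b show "(y, x) \<in> rel" by (auto intro: relI[of _ _ ?c])
  qed
  show "trans rel"
  proof (rule transI)
    fix x y z assume xy: "(x, y) \<in> rel" and yz: "(y, z) \<in> rel"
    have A: "x \<in> A" "y \<in> A" "z \<in> A" using xy yz by (auto dest: rel_carrier)
    \<comment> \<open>Relatedness to \<open>y\<close> is used twice, first on \<open>b\<close> and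
      then on the result; the two copies of \<open>y\<close> cancel.\<close>
    have "tern x y (tern y z b) \<in> B" using xy yz b by (blast intro: rel_tern_mem)
    moreover have "tern x y (tern y z b) = tern x z b"
      using A b by (simp add: tern_assoc tern_right B_in)
    ultimately show "(x, z) \<in> rel" using A b by (auto intro: relI)
  qed
qed

lemma rel_refl: "x \<in> A \<Longrightarrow> (x, x) \<in> rel"
  using equiv_rel by (auto simp: equiv_def refl_on_def)

lemma rel_sym: "(x, y) \<in> rel \<Longrightarrow> (y, x) \<in> rel"
  using equiv_rel by (auto simp: equiv_def sym_def)

lemma rel_trans: "(x, y) \<in> rel \<Longrightarrow> (y, z) \<in> rel \<Longrightarrow> (x, z) \<in> rel"
  using equiv_rel by (auto simp: equiv_def trans_def)

lemma rel_morphism: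
  assumes f: "heap_morphism A tern A tern f"
    and fB: "\<And>b c. \<lbrakk>b \<in> B; c \<in> B\<rbrakk> \<Longrightarrow> (f b, f c) \<in> rel"
    and xy: "(x, y) \<in> rel"
  shows "(f x, f y) \<in> rel"
proof -
  obtain b where b: "b \<in> B" using B_nonempty by blast
  let ?c = "tern x y b"
  have c: "?c \<in> B" using xy b by (rule rel_tern_mem)
  have A: "x \<in> A" "y \<in> A" "b \<in> A" using xy b by (auto dest: rel_carrier B_in)
  have fA: "f x \<in> A" "f y \<in> A" "f b \<in> A" "f ?c \<in> A"
    using f A by (auto simp: heap_morphism_def tern_closed)
  have fc: "f ?c = tern (f x) (f y) (f b)" using f A by (auto simp: heap_morphism_def)
  \<comment> \<open>\<open>f b\<close> need not lie in \<open>B\<close>, so it cannot serve as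
    witness. Correcting it to \<open>tern (f b) (f ?c) b\<close> gives an element of
    \<open>B\<close>, because \<open>b\<close> and \<open>?c\<close> both lie in \<open>B\<close>
    and thus have related images.\<close>
  have "tern (f x) (f y) (tern (f b) (f ?c) b) = tern (f ?c) (f ?c) b"
    using tern_assoc[of "f x" "f y" "f b" "f ?c" b] fA A by (simp only: fc)
  also have "\<dots> = b" using fA A by (simp add: tern_left)
  finally have "tern (f x) (f y) (tern (f b) (f ?c) b) \<in> B" using b by simp
  moreover have "tern (f b) (f ?c) b \<in> B" using fB[OF b c] b by (rule rel_tern_mem)
  ultimately show ?thesis using fA by (auto intro: relI)
qed

text \<open>One argument is replaced at a time and the steps are joined by transitivity. The third
  position reduces to the first by commutativity.\<close>

lemma rel_tern:
  assumes "(x, x') \<in> rel" "(y, y') \<in> rel" "(z, z') \<in> rel"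
  shows "(tern x y z, tern x' y' z') \<in> rel"
proof -
  obtain b where b: "b \<in> B" using B_nonempty by blast
  then have bA: "b \<in> A" by (rule B_in)
  have A: "x \<in> A" "x' \<in> A" "y \<in> A" "y' \<in> A" "z \<in> A" "z' \<in> A"
    using assms by (auto dest: rel_carrier)
  have left: "(tern u v w, tern u' v w) \<in> rel"
    if "(u, u') \<in> rel" "v \<in> A" "w \<in> A" for u u' v w
  proof -
    have uA: "u \<in> A" "u' \<in> A" using that by (auto dest: rel_carrier)
    \<comment> \<open>The common \<open>v\<close> and \<open>w\<close> cancel, so the two results
      differ exactly as \<open>u\<close> and \<open>u'\<close> do.\<close>
    have "tern (tern u v w) (tern u' v w) b = tern (tern (tern u v w) w v) u' b"
      using uA that bA by (simp add: tern_assoc_mid tern_closed)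
    also have "tern (tern u v w) w v = u"
      using uA that by (simp add: tern_left tern_right flip: tern_assoc)
    finally have "tern (tern u v w) (tern u' v w) b \<in> B" using that b by (simp add: rel_tern_mem)
    with uA that b show ?thesis by (auto intro: relI tern_closed)
  qed
  have mid: "(tern u v w, tern u v' w) \<in> rel"
    if "(v, v') \<in> rel" "u \<in> A" "w \<in> A" for u v v' w
  proof -
    have vA: "v \<in> A" "v' \<in> A" using that by (auto dest: rel_carrier)
    have "tern (tern u v w) (tern u v' w) b = tern (tern (tern u v w) w v') u b"
      using vA that bA by (simp add: tern_assoc_mid tern_closed)
    also have "tern (tern u v w) w v' = tern u v v'"
      using vA that by (simp add: tern_left flip: tern_assoc)
    \<comment> \<open>Commutativity brings the two copies of \<open>u\<close> together. The
      difference left is that of \<open>v'\<close> and \<open>v\<close>, in reversed order, hence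
      the later use of \<open>rel_sym\<close>.\<close>
    also have "\<dots> = tern v' v u" using vA that by (simp add: tern_commute)
    also have "tern (tern v' v u) u b = tern v' v b"
      using vA that bA by (simp add: tern_left flip: tern_assoc)
    finally have "tern (tern u v w) (tern u v' w) b \<in> B"
      using that b by (simp add: rel_tern_mem rel_sym)
    with vA that b show ?thesis by (auto intro: relI tern_closed)
  qed
  have "(tern x y z, tern x' y z) \<in> rel" using left assms A by blast
  moreover have "(tern x' y z, tern x' y' z) \<in> rel" using mid assms A by blast
  moreover have "(tern x' y' z, tern x' y' z') \<in> rel"
    using left[OF assms(3), of y' x'] A by (simp add: tern_commute[of x'])
  ultimately show ?thesis by (blast intro: rel_trans)
qed

lemma cls_eqI: "(x, y) \<in> rel \<Longrightarrow> cls x = cls y"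
  using equiv_rel by (rule equiv_class_eq)

lemma cls_in: "a \<in> A \<Longrightarrow> cls a \<in> A // rel"
  by (rule quotientI)

text \<open>Well-definedness: by \<open>rel_tern\<close> all classes in the union coincide, and the
  union is over non-empty sets because each representative lies in its own class.\<close>

lemma quot_tern_cls:
  assumes "x \<in> A" "y \<in> A" "z \<in> A"
  shows "quot_tern rel tern (cls x) (cls y) (cls z) = cls (tern x y z)"
proof -
  have "cls (tern x' y' z') = cls (tern x y z)"
    if "x' \<in> cls x" "y' \<in> cls y" "z' \<in> cls z" for x' y' z'
    using that by (auto intro!: cls_eqI rel_tern intro: rel_sym)
  moreover have "x \<in> cls x" "y \<in> cls y" "z \<in> cls z" using assms by (auto intro: rel_refl)
  ultimately show ?thesis unfolding quot_tern_def by blast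
qed

lemma abelian_heap_quotient: "abelian_heap (A // rel) (quot_tern rel tern)"
proof unfold_locales
  fix X Y Z assume "X \<in> A // rel" "Y \<in> A // rel" "Z \<in> A // rel"
  then show "quot_tern rel tern X Y Z = quot_tern rel tern Z Y X"
    by (elim quotientE) (simp add: quot_tern_cls tern_commute)
qed (auto elim!: quotientE
    simp: quot_tern_cls cls_in tern_closed tern_assoc tern_left tern_right)

end

section \<open>The quotient of a Lie affgebra by an ideaf\<close>

locale ideaf_quotient = lie_affgebra A tern act br
  for A :: "'a set" and tern :: "'a \<Rightarrow> 'a \<Rightarrow> 'a \<Rightarrow> 'a"
    and act :: "'k::field \<Rightarrow> 'a \<Rightarrow> 'a \<Rightarrow> 'a" and br :: "'a \<Rightarrow> 'a \<Rightarrow> 'a" +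
  fixes B :: "'a set"
  assumes ideaf: "ideaf A tern act br B"
begin

sublocale heap_quotient A tern B
  using ideaf by unfold_locales (auto simp: ideaf_def affine_subspace_def)

lemma B_act: "\<lbrakk>x \<in> B; y \<in> B\<rbrakk> \<Longrightarrow> act \<alpha> x y \<in> B"
  using ideaf by (auto simp: ideaf_def affine_subspace_def)

lemma B_br: "\<lbrakk>a \<in> A; b \<in> B\<rbrakk> \<Longrightarrow> br a b \<in> B \<and> br b a \<in> B"
  using ideaf by (auto simp: ideaf_def)

text \<open>Supplies the hypothesis of \<open>rel_morphism\<close> for any map that sends
  \<open>B\<close> into itself.\<close>

lemma rel_B: "\<lbrakk>b \<in> B; c \<in> B\<rbrakk> \<Longrightarrow> (b, c) \<in> rel"
  by (auto intro: relI[of _ _ c] simp: B_in tern_right)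

lemma act_closed: "\<lbrakk>x \<in> A; y \<in> A\<rbrakk> \<Longrightarrow> act \<alpha> x y \<in> A"
  using act_morphism_point by (auto simp: heap_morphism_def)

lemma br_closed: "\<lbrakk>x \<in> A; y \<in> A\<rbrakk> \<Longrightarrow> br x y \<in> A"
  using br_affine_right by (auto simp: affine_map_def heap_morphism_def)

lemma rel_act:
  assumes xx': "(x, x') \<in> rel" and yy': "(y, y') \<in> rel"
  shows "(act \<alpha> x y, act \<alpha> x' y') \<in> rel"
proof -
  have A: "x \<in> A" "x' \<in> A" "y \<in> A" "y' \<in> A" using assms by (auto dest: rel_carrier)
  \<comment> \<open>A base point inside \<open>B\<close> makes the action map \<open>B\<close> into
    itself, by closure of the affine subspace.\<close>
  obtain o' where o': "o' \<in> B" using B_nonempty by blast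
  then have o'A: "o' \<in> A" by (rule B_in)
  have point: "(act \<alpha> o' u, act \<alpha> o' v) \<in> rel" if "(u, v) \<in> rel" for u v
    using act_morphism_point[OF o'A] _ that
    by (rule rel_morphism) (simp add: rel_B B_act o')
  \<comment> \<open>By base change these two brackets are the actions at \<open>x\<close> and
    \<open>x'\<close>; the varying base points now occur only as arguments.\<close>
  have "(tern (act \<alpha> o' y) (act \<alpha> o' x) x, tern (act \<alpha> o' y') (act \<alpha> o' x') x') \<in> rel"
    using assms by (intro rel_tern point)
  then show ?thesis using A o'A by (simp flip: act_base_change)
qed

text \<open>The ideaf absorbs brackets on both sides, so bracketing with a fixed element on either
  side maps \<open>B\<close> into itself; the two arguments are replaced in turn.\<close>

lemma rel_br:
  assumes "(x, x') \<in> rel" "(y, y') \<in> rel"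
  shows "(br x y, br x' y') \<in> rel"
proof -
  have A: "x' \<in> A" "y \<in> A" using assms by (auto dest: rel_carrier)
  have "heap_morphism A tern A tern (\<lambda>a. br a y)"
    using br_affine_left[OF A(2)] by (simp add: affine_map_def)
  then have "(br x y, br x' y) \<in> rel"
    using _ assms(1) by (rule rel_morphism) (simp add: rel_B B_br A)
  moreover have "heap_morphism A tern A tern (\<lambda>b. br x' b)"
    using br_affine_right[OF A(1)] by (simp add: affine_map_def)
  then have "(br x' y, br x' y') \<in> rel"
    using _ assms(2) by (rule rel_morphism) (simp add: rel_B B_br A)
  ultimately show ?thesis by (rule rel_trans)
qed

lemma quot_act_cls:
  assumes "x \<in> A" "y \<in> A"
  shows "quot_act rel act \<alpha> (cls x) (cls y) = cls (act \<alpha> x y)"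
proof -
  have "cls (act \<alpha> x' y') = cls (act \<alpha> x y)" if "x' \<in> cls x" "y' \<in> cls y" for x' y'
    using that by (auto intro!: cls_eqI rel_act intro: rel_sym)
  moreover have "x \<in> cls x" "y \<in> cls y" using assms by (auto intro: rel_refl)
  ultimately show ?thesis unfolding quot_act_def by blast
qed

lemma quot_br_cls:
  assumes "x \<in> A" "y \<in> A"
  shows "quot_br rel br (cls x) (cls y) = cls (br x y)"
proof -
  have "cls (br x' y') = cls (br x y)" if "x' \<in> cls x" "y' \<in> cls y" for x' y'
    using that by (auto intro!: cls_eqI rel_br intro: rel_sym)
  moreover have "x \<in> cls x" "y \<in> cls y" using assms by (auto intro: rel_refl)
  ultimately show ?thesis unfolding quot_br_def by blast
qed

lemmas quot_cls = quot_tern_cls quot_act_cls quot_br_cls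
  and closed = tern_closed act_closed br_closed cls_in

text \<open>This and the next two lemmas turn the morphism assumptions into equations on
  representatives, the form in which they pass to classes.\<close>

lemma act_tern:
  "\<lbrakk>x \<in> A; u \<in> A; v \<in> A; w \<in> A\<rbrakk>
    \<Longrightarrow> act \<alpha> x (tern u v w) = tern (act \<alpha> x u) (act \<alpha> x v) (act \<alpha> x w)"
  using act_morphism_point[of x \<alpha>] by (simp add: heap_morphism_def)

lemma act_field_tern:
  "\<lbrakk>x \<in> A; y \<in> A\<rbrakk>
    \<Longrightarrow> act (field_tern \<alpha> \<beta> \<gamma>) x y = tern (act \<alpha> x y) (act \<beta> x y) (act \<gamma> x y)"
  using act_morphism_scalar[of x y] by (simp add: heap_morphism_def)

lemma br_simps:
  assumes "a \<in> A" "x \<in> A" "y \<in> A" "z \<in> A"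
  shows "br a (tern x y z) = tern (br a x) (br a y) (br a z)"
    and "br (tern x y z) a = tern (br x a) (br y a) (br z a)"
    and "br a (act \<alpha> x y) = act \<alpha> (br a x) (br a y)"
    and "br (act \<alpha> x y) a = act \<alpha> (br x a) (br y a)"
  using assms br_affine_left[of a] br_affine_right[of a]
  by (simp_all add: affine_map_def heap_morphism_def)

lemma affine_space_quotient: "affine_space (A // rel) (quot_tern rel tern) (quot_act rel act)"
proof -
  interpret Q: abelian_heap "A // rel" "quot_tern rel tern" by (rule abelian_heap_quotient)
  show ?thesis
  proof unfold_locales
    show "A // rel \<noteq> {}" using nonempty by (simp add: quotient_def)
  next
    fix X Y Z and \<alpha> :: 'k
    assume "X \<in> A // rel" "Y \<in> A // rel" "Z \<in> A // rel"
    then show "quot_act rel act \<alpha> X Y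
        = quot_tern rel tern (quot_act rel act \<alpha> Z Y) (quot_act rel act \<alpha> Z X) X"
      \<comment> \<open>Base change is read from right to left, since the auxiliary base point
        occurs only on its right-hand side.\<close>
      by (auto elim!: quotientE simp: quot_cls closed simp flip: act_base_change)
  qed (auto elim!: quotientE
      simp: heap_morphism_def quot_cls closed act_tern act_field_tern act_mult act_zero act_one)
qed

lemma lie_affgebra_quotient:
  "lie_affgebra (A // rel) (quot_tern rel tern) (quot_act rel act) (quot_br rel br)"
proof -
  interpret Q: affine_space "A // rel" "quot_tern rel tern" "quot_act rel act"
    by (rule affine_space_quotient)
  show ?thesis
  proof unfold_locales
    fix X Y Z assume "X \<in> A // rel" "Y \<in> A // rel" "Z \<in> A // rel"
    then show "tern5 (quot_tern rel tern)
        (quot_br rel br X (quot_br rel br Y Z)) (quot_br rel br X (quot_br rel br X X))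
        (quot_br rel br Y (quot_br rel br Z X)) (quot_br rel br Y (quot_br rel br Y Y))
        (quot_br rel br Z (quot_br rel br X Y))
      = quot_br rel br Z (quot_br rel br Z Z)"
      \<comment> \<open>The Jacobi identity is unfolded into nested ternary brackets on both levels,
        so that \<open>quot_tern_cls\<close> reduces it to the identity for representatives.\<close>
      by (auto elim!: quotientE
          simp: tern5_def quot_cls closed br_jacobi[unfolded tern5_def])
  qed (auto elim!: quotientE
      simp: affine_map_def heap_morphism_def quot_cls closed br_simps br_antisym)
qed

end

theorem mainTheorem8:
  fixes A :: "'a set"
    and tern :: "'a \<Rightarrow> 'a \<Rightarrow> 'a \<Rightarrow> 'a"
    and act :: "'k::field \<Rightarrow> 'a \<Rightarrow> 'a \<Rightarrow> 'a"
    and br :: "'a \<Rightarrow> 'a \<Rightarrow> 'a"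
    and B :: "'a set"
  assumes "CHAR('k) \<noteq> 2"
    and "lie_affgebra A tern act br"
    and "ideaf A tern act br B"
  shows "equiv A (sub_rel A tern B) \<and>
    (\<forall>a1\<in>A. \<forall>a2\<in>A. \<forall>a3\<in>A.
      quot_tern (sub_rel A tern B) tern
        (sub_rel A tern B `` {a1}) (sub_rel A tern B `` {a2}) (sub_rel A tern B `` {a3})
      = sub_rel A tern B `` {tern a1 a2 a3}) \<and>
    (\<forall>\<alpha>. \<forall>a1\<in>A. \<forall>a2\<in>A.
      quot_act (sub_rel A tern B) act \<alpha> (sub_rel A tern B `` {a1}) (sub_rel A tern B `` {a2})
      = sub_rel A tern B `` {act \<alpha> a1 a2}) \<and>
    (\<forall>a1\<in>A. \<forall>a2\<in>A.
      quot_br (sub_rel A tern B) br (sub_rel A tern B `` {a1}) (sub_rel A tern B `` {a2})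
      = sub_rel A tern B `` {br a1 a2}) \<and>
    lie_affgebra (A // sub_rel A tern B)
      (quot_tern (sub_rel A tern B) tern)
      (quot_act (sub_rel A tern B) act)
      (quot_br (sub_rel A tern B) br)"
proof -
  interpret ideaf_quotient A tern act br B
    using assms by (simp add: ideaf_quotient_def ideaf_quotient_axioms_def)
  show ?thesis using equiv_rel quot_cls lie_affgebra_quotient by blast
qed

end
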